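(* Let $f=h+\overline{g}$ be a sense-preserving univalent harmonic mapping of the unit disk $\mathbb{D}$. Assume that its complex dilatation $\omega=g'/h'$ satisfies $$|\omega(z)|\le k<1\qquad\text{for all } z\in\mathbb{D}.$$ Then for every measurable set $E\subset\mathbb{D}$, $$(1-k^2)\int_E|h'(z)|^2\,dA(z)\le m(f(E))\le\int_E|h'(z)|^2\,dA(z).$$
   Context: $\mathbb{D}=\{z\in\mathbb{C}:|z|<1\}$. $m$ denotes planar Lebesgue measure and $dA$ integration with respect to it. A complex-valued function $f$ on $\mathbb{D}$ is harmonic if $f=h+\overline{g}$ with $h,g$ analytic in $\mathbb{D}$; its Jacobian is $J_f(z)=|h'(z)|^2-|g'(z)|^2$. It is sense-preserving if $J_f(z)>0$ for all $z\in\mathbb{D}$ (so that $h'$ has no zeros and $\omega$ is defined on $\mathbb{D}$), and univalent if it is injective. Here $f$ is a mapping defined on $\mathbb{D}$ with values in $\mathbb{C}$. *)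

theory Defs
  imports "HOL-Complex_Analysis.Complex_Analysis"
begin

abbreviation unit_disk :: "complex set" where
  "unit_disk \<equiv> ball 0 1"

text \<open>A harmonic mapping of the disk is presented together with its decomposition. The values of
  \<open>f\<close>, \<open>h\<close> and \<open>g\<close> outside the disk are irrelevant.\<close>

definition harmonic_decomposition ::
    "(complex \<Rightarrow> complex) \<Rightarrow> (complex \<Rightarrow> complex) \<Rightarrow> (complex \<Rightarrow> complex) \<Rightarrow> bool" where
  "harmonic_decomposition f h g \<longleftrightarrow>
     h analytic_on unit_disk \<and> g analytic_on unit_disk \<and>
     (\<forall>z\<in>unit_disk. f z = h z + cnj (g z))"

definition jacobian :: "(complex \<Rightarrow> complex) \<Rightarrow> (complex \<Rightarrow> complex) \<Rightarrow> complex \<Rightarrow> real" where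
  "jacobian h g z = (cmod (deriv h z))\<^sup>2 - (cmod (deriv g z))\<^sup>2"

definition sense_preserving :: "(complex \<Rightarrow> complex) \<Rightarrow> (complex \<Rightarrow> complex) \<Rightarrow> bool" where
  "sense_preserving h g \<longleftrightarrow> (\<forall>z\<in>unit_disk. jacobian h g z > 0)"

definition univalent :: "(complex \<Rightarrow> complex) \<Rightarrow> bool" where
  "univalent f \<longleftrightarrow> inj_on f unit_disk"

text \<open>Only meaningful where \<open>deriv h z \<noteq> 0\<close>, which holds throughout the disk for a
  sense-preserving mapping.\<close>

definition dilatation :: "(complex \<Rightarrow> complex) \<Rightarrow> (complex \<Rightarrow> complex) \<Rightarrow> complex \<Rightarrow> complex" where
  "dilatation h g z = deriv g z / deriv h z"

end

theory Submission
  imports Defs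
begin

text \<open>The real derivative of \<open>f\<close> at \<open>z\<close> is \<open>w \<mapsto> h'(z) w + cnj (g'(z) w)\<close>, with determinant
  \<open>J = |h'|\<^sup>2 - |g'|\<^sup>2 > 0\<close>. As \<open>f\<close> is injective, the area formula gives \<open>m(f(E)) = \<integral>\<^sub>E J dA\<close>,
  and \<open>|g'| \<le> k |h'|\<close> squeezes \<open>J\<close> between \<open>(1 - k\<^sup>2) |h'|\<^sup>2\<close> and \<open>|h'|\<^sup>2\<close>.\<close>

text \<open>Keeps \<open>$\<close> unambiguous as the component selector of vectors in
  \<open>real^2\<close>.\<close>

no_notation fps_nth (infixl \<open>$\<close> 75)

text \<open>\<open>has_measure_differentiable_image\<close> links a finite measure of the image to
  the integral of the Jacobian. Stating the formula in \<open>ennreal\<close> covers images of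
  infinite measure too: then the Jacobian is not integrable and both sides are infinite.\<close>

lemma emeasure_differentiable_image_eq:
  fixes f :: "real^'n::{finite,wellorder} \<Rightarrow> real^'n::_"
  assumes S: "S \<in> sets lebesgue"
    and der: "\<And>x. x \<in> S \<Longrightarrow> (f has_derivative f' x) (at x within S)"
    and inj: "inj_on f S"
  shows "emeasure lebesgue (f ` S) = (\<integral>\<^sup>+x\<in>S. ennreal \<bar>det (matrix (f' x))\<bar> \<partial>lebesgue)"
proof -
  let ?J = "\<lambda>x. \<bar>det (matrix (f' x))\<bar>"
  note iff = has_measure_differentiable_image [OF S der inj]
  have fS: "f ` S \<in> sets lebesgue"
    using S der by (intro differentiable_image_in_sets_lebesgue)
      (auto simp: differentiable_on_def differentiable_def)
  have meas: "?J \<in> borel_measurable (lebesgue_on S)"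
    using borel_measurable_det_Jacobian [OF S der] by measurable
  show ?thesis
  proof (cases "f ` S \<in> lmeasurable")
    case True
    then have "(?J has_integral measure lebesgue (f ` S)) S"
      using iff by blast
    then have "(\<integral>\<^sup>+x\<in>S. ennreal (?J x) \<partial>lborel) = ennreal (measure lebesgue (f ` S))"
      by (intro nn_integral_has_integral_lebesgue') auto
    then show ?thesis
      using True by (simp add: emeasure_eq_measure2 nn_integral_completion)
  next
    case False
    \<comment> \<open>Lebesgue integrability would give a gauge integral over \<open>S\<close>, and
      \<open>iff\<close> would then make the measure of the image finite.\<close>
    then have "\<not> integrable (lebesgue_on S) ?J"
      using integrable_on_lebesgue_on [OF _ S] iff by blast
    then have "(\<integral>\<^sup>+x. ennreal (?J x) \<partial>lebesgue_on S) = \<infinity>"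
      using meas by (auto simp: integrable_iff_bounded simp flip: less_top)
    moreover have "\<not> emeasure lebesgue (f ` S) < \<infinity>"
      using fmeasurableI [OF fS] False by blast
    then have "emeasure lebesgue (f ` S) = \<infinity>"
      unfolding infinity_ennreal_def using top.not_eq_extremum by blast
    ultimately show ?thesis
      using S by (simp add: nn_integral_restrict_space)
  qed
qed

text \<open>The area formula above speaks of \<open>real^'n\<close>, so it is carried to the complex
  plane along this linear identification with \<open>real^2\<close>.\<close>

definition complex_to_vec :: "complex \<Rightarrow> real^2" where
  "complex_to_vec z = vector [Re z, Im z]"

definition vec_to_complex :: "real^2 \<Rightarrow> complex" where
  "vec_to_complex x = Complex (x$1) (x$2)"

lemma vec_to_complex_inverse [simp]: "complex_to_vec (vec_to_complex x) = x"
  by (simp add: complex_to_vec_def vec_to_complex_def vec_eq_iff forall_2)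

lemma complex_to_vec_inverse [simp]: "vec_to_complex (complex_to_vec z) = z"
  by (simp add: complex_to_vec_def vec_to_complex_def)

lemma bounded_linear_complex_to_vec: "bounded_linear complex_to_vec"
  by (simp add: linear_conv_bounded_linear [symmetric] linear_iff complex_to_vec_def vec_eq_iff forall_2)

lemma bounded_linear_vec_to_complex: "bounded_linear vec_to_complex"
  by (simp add: linear_conv_bounded_linear [symmetric] linear_iff vec_to_complex_def complex_eq_iff)

lemma complex_to_vec_image_eq_vimage: "complex_to_vec ` S = vec_to_complex -` S"
  by (force simp: image_iff intro: vec_to_complex_inverse [symmetric])

lemma prod_Basis_real2:
  fixes f :: "real^2 \<Rightarrow> 'a::comm_monoid_mult"
  shows "prod f Basis = f (axis 1 1) * f (axis 2 1)"
proof -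
  have B: "Basis = {axis 1 1, axis 2 1 :: real^2}"
    by (auto simp: Basis_vec_def UNIV_2)
  have "axis 1 1 \<noteq> (axis 2 1 :: real^2)"
    by (simp add: axis_eq_axis)
  then show ?thesis
    unfolding B by simp
qed

text \<open>\<open>lborel\<close> is determined by its values on boxes, and the preimage of a box is
  the box in the complex plane with the same side lengths.\<close>

lemma lborel_distr_complex_to_vec: "distr lborel borel complex_to_vec = lborel"
proof (rule lborel_eqI [symmetric])
  fix l u :: "real^2"
  assume le: "\<And>b. b \<in> Basis \<Longrightarrow> l \<bullet> b \<le> u \<bullet> b"
  have le': "l $ i \<le> u $ i" for i
    using le [of "axis i 1"] by (simp add: inner_axis)
  have [measurable]: "complex_to_vec \<in> borel_measurable borel"
    by (intro borel_measurable_continuous_onI linear_continuous_on bounded_linear_complex_to_vec)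
  have "complex_to_vec -` box l u = box (vec_to_complex l) (vec_to_complex u)"
    by (auto simp: mem_box_cart mem_box Basis_complex_def complex_to_vec_def vec_to_complex_def forall_2)
  then show "emeasure (distr lborel borel complex_to_vec) (box l u) = ennreal (\<Prod>b\<in>Basis. (u - l) \<bullet> b)"
    using le' by (simp add: emeasure_distr emeasure_lborel_box_eq Basis_complex_def
        vec_to_complex_def prod_Basis_real2 inner_axis)
qed simp

text \<open>Passes from Borel to Lebesgue sets by completing the measures. This works because
  preimages of null sets are null, which \<open>dl\<close> supplies.\<close>

lemma
  shows measurable_complex_to_vec: "complex_to_vec \<in> lebesgue \<rightarrow>\<^sub>M lebesgue"
    and lebesgue_distr_complex_to_vec: "distr lebesgue lebesgue complex_to_vec = lebesgue"
proof -
  have [measurable]: "complex_to_vec \<in> borel_measurable borel"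
    by (intro borel_measurable_continuous_onI linear_continuous_on bounded_linear_complex_to_vec)
  have dl: "distr lebesgue lborel complex_to_vec = lborel"
    using lborel_distr_complex_to_vec by (simp add: distr_completion cong: distr_cong)
  show "complex_to_vec \<in> lebesgue \<rightarrow>\<^sub>M lebesgue"
    by (simp add: completion.measurable_completion2 dl measurable_completion)
  show "distr lebesgue lebesgue complex_to_vec = lebesgue"
    using completion.completion_distr_eq [of complex_to_vec lborel lborel]
    by (simp add: dl measurable_completion)
qed

text \<open>The preimage is also the image under the linear map \<open>complex_to_vec\<close>, and
  differentiable images of Lebesgue sets in equal dimension are Lebesgue sets.\<close>

lemma sets_lebesgue_vec_to_complex_vimage:
  assumes "S \<in> sets lebesgue"
  shows "vec_to_complex -` S \<in> sets lebesgue"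
  unfolding complex_to_vec_image_eq_vimage [symmetric]
  using assms
  by (intro differentiable_image_in_sets_lebesgue)
    (auto intro!: linear_imp_differentiable_on bounded_linear.linear [OF bounded_linear_complex_to_vec])

lemma emeasure_complex_to_vec_image:
  assumes "S \<in> sets lebesgue"
  shows "emeasure lebesgue (complex_to_vec ` S) = emeasure lebesgue S"
proof -
  have "emeasure lebesgue (complex_to_vec ` S)
      = emeasure (distr lebesgue lebesgue complex_to_vec) (vec_to_complex -` S)"
    by (simp add: lebesgue_distr_complex_to_vec complex_to_vec_image_eq_vimage)
  also have "\<dots> = emeasure lebesgue (complex_to_vec -` vec_to_complex -` S)"
    using assms by (subst emeasure_distr)
      (auto simp: measurable_complex_to_vec sets_lebesgue_vec_to_complex_vimage)
  finally show ?thesis by (simp add: vimage_def)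
qed

text \<open>The columns of the matrix are \<open>L 1\<close> and \<open>L \<i>\<close> read as
  vectors, and the determinant with columns \<open>u\<close>, \<open>v\<close> is
  \<open>Im (cnj u * v)\<close>.\<close>

lemma det_matrix_complex_conjugate:
  "det (matrix (\<lambda>x. complex_to_vec (L (vec_to_complex x)))) = Im (cnj (L 1) * L \<i>)"
proof -
  have "vec_to_complex (axis 1 1) = 1" "vec_to_complex (axis 2 1) = \<i>"
    by (simp_all add: vec_to_complex_def complex_eq_iff axis_def)
  then show ?thesis
    by (simp add: det_2 matrix_def complex_to_vec_def)
qed

text \<open>Conjugating \<open>f\<close> by the identification gives a map \<open>F\<close> of
  \<open>real^2\<close>, to which the real area formula applies. Since the identification preserves
  measure, both the area of the image and the integral can be read back in the complex
  plane.\<close>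

lemma emeasure_differentiable_image_eq_complex:
  fixes f :: "complex \<Rightarrow> complex"
  assumes S: "S \<in> sets lebesgue"
    and der: "\<And>z. z \<in> S \<Longrightarrow> (f has_derivative f' z) (at z within S)"
    and inj: "inj_on f S"
  shows "emeasure lebesgue (f ` S) = (\<integral>\<^sup>+z\<in>S. ennreal \<bar>Im (cnj (f' z 1) * f' z \<i>)\<bar> \<partial>lebesgue)"
proof -
  define T where "T = vec_to_complex -` S"
  define F where "F x = complex_to_vec (f (vec_to_complex x))" for x
  define F' where "F' x y = complex_to_vec (f' (vec_to_complex x) (vec_to_complex y))" for x y
  let ?J = "\<lambda>x. \<bar>det (matrix (F' x))\<bar>"
  have T: "T \<in> sets lebesgue"
    unfolding T_def by (rule sets_lebesgue_vec_to_complex_vimage [OF S])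
  have T_image: "vec_to_complex ` T = S"
    unfolding T_def complex_to_vec_image_eq_vimage [symmetric] by (force simp: image_iff)
  have der_F: "(F has_derivative F' x) (at x within T)" if "x \<in> T" for x
  proof -
    have "(vec_to_complex has_derivative vec_to_complex) (at x within T)"
      by (rule bounded_linear_imp_has_derivative [OF bounded_linear_vec_to_complex])
    moreover have "(f has_derivative f' (vec_to_complex x)) (at (vec_to_complex x) within vec_to_complex ` T)"
      using that der unfolding T_image by (simp add: T_def)
    ultimately have "((\<lambda>y. f (vec_to_complex y)) has_derivative (\<lambda>y. f' (vec_to_complex x) (vec_to_complex y)))
        (at x within T)"
      by (rule has_derivative_in_compose)
    then show ?thesis
      unfolding F_def F'_def
      by (rule bounded_linear.has_derivative [OF bounded_linear_complex_to_vec])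
  qed
  have inj_F: "inj_on F T"
    using inj unfolding inj_on_def F_def T_def
    by (metis complex_to_vec_inverse vec_to_complex_inverse vimageE)
  have F_image: "F ` T = complex_to_vec ` f ` S"
    unfolding T_image [symmetric] F_def by (simp add: image_image)
  have "f differentiable_on S"
    using der by (auto simp: differentiable_on_def differentiable_def)
  then have fS: "f ` S \<in> sets lebesgue"
    using S by (intro differentiable_image_in_sets_lebesgue) auto
  \<comment> \<open>The substitution in the integral below needs a measurable integrand; the
    Jacobian determinant of a differentiable map is one.\<close>
  have "?J \<in> borel_measurable (lebesgue_on T)"
    using borel_measurable_det_Jacobian [OF T der_F] by measurable
  then have meas: "(\<lambda>x. ennreal (?J x) * indicator T x) \<in> borel_measurable lebesgue"
    using T by (subst borel_measurable_restrict_space_iff_ennreal [symmetric]) auto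
  have "emeasure lebesgue (f ` S) = emeasure lebesgue (F ` T)"
    unfolding F_image by (rule emeasure_complex_to_vec_image [OF fS, symmetric])
  also have "\<dots> = (\<integral>\<^sup>+x\<in>T. ennreal (?J x) \<partial>lebesgue)"
    by (rule emeasure_differentiable_image_eq [OF T der_F inj_F])
  \<comment> \<open>Writing the measure on \<open>real^2\<close> as a push-forward turns the
    integral into one over the complex plane.\<close>
  also have "\<dots> = (\<integral>\<^sup>+x\<in>T. ennreal (?J x) \<partial>distr lebesgue lebesgue complex_to_vec)"
    by (simp add: lebesgue_distr_complex_to_vec)
  also have "\<dots> = (\<integral>\<^sup>+z. ennreal (?J (complex_to_vec z)) * indicator T (complex_to_vec z) \<partial>lebesgue)"
    using meas by (intro nn_integral_distr measurable_complex_to_vec) simp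
  also have "\<dots> = (\<integral>\<^sup>+z\<in>S. ennreal \<bar>Im (cnj (f' z 1) * f' z \<i>)\<bar> \<partial>lebesgue)"
  proof (rule nn_integral_cong)
    fix z
    show "ennreal (?J (complex_to_vec z)) * indicator T (complex_to_vec z)
        = ennreal \<bar>Im (cnj (f' z 1) * f' z \<i>)\<bar> * indicator S z"
      using det_matrix_complex_conjugate [of "f' z"]
      by (simp add: F'_def [abs_def] T_def indicator_def)
  qed
  finally show ?thesis .
qed

lemma harmonic_has_derivative:
  assumes "h analytic_on {z}" "g analytic_on {z}"
  shows "((\<lambda>w. h w + cnj (g w)) has_derivative (\<lambda>w. deriv h z * w + cnj (deriv g z * w))) (at z)"
proof -
  have "(h has_derivative (*) (deriv h z)) (at z)" "(g has_derivative (*) (deriv g z)) (at z)"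
    using assms by (auto simp: has_field_derivative_def [symmetric] DERIV_deriv_iff_field_differentiable
        analytic_on_imp_differentiable_at)
  then show ?thesis
    by (intro has_derivative_add has_derivative_cnj)
qed

text \<open>The factors \<open>1\<close> are kept so that the left-hand side is syntactically the determinant
  \<open>Im (cnj (L 1) * L \<i>)\<close> of \<open>L w = a * w + cnj (b * w)\<close>.\<close>

lemma jacobian_add_cnj:
  fixes a b :: complex
  shows "Im (cnj (a * 1 + cnj (b * 1)) * (a * \<i> + cnj (b * \<i>))) = (cmod a)\<^sup>2 - (cmod b)\<^sup>2"
  unfolding cmod_power2 by (simp add: power2_eq_square algebra_simps)

theorem proposition3p1:
  fixes f h g :: "complex \<Rightarrow> complex" and k :: real and E :: "complex set"
  assumes "harmonic_decomposition f h g"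
    and "sense_preserving h g"
    and "univalent f"
    and "\<forall>z\<in>unit_disk. cmod (dilatation h g z) \<le> k"
    and "k < 1"
    and "E \<in> sets lebesgue"
    and "E \<subseteq> unit_disk"
  shows "f ` E \<in> sets lebesgue
    \<and> ennreal (1 - k\<^sup>2) * (\<integral>\<^sup>+z\<in>E. ennreal ((cmod (deriv h z))\<^sup>2) \<partial>lebesgue)
        \<le> emeasure lebesgue (f ` E)
    \<and> emeasure lebesgue (f ` E)
        \<le> (\<integral>\<^sup>+z\<in>E. ennreal ((cmod (deriv h z))\<^sup>2) \<partial>lebesgue)"
proof -
  have h: "h analytic_on unit_disk" and g: "g analytic_on unit_disk"
    and f_eq: "\<And>z. z \<in> unit_disk \<Longrightarrow> f z = h z + cnj (g z)"
    using assms(1) by (auto simp: harmonic_decomposition_def)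
  have der: "(f has_derivative (\<lambda>w. deriv h z * w + cnj (deriv g z * w))) (at z within E)"
    if "z \<in> E" for z
  proof -
    have z: "z \<in> unit_disk"
      using that assms(7) by blast
    then have "((\<lambda>w. h w + cnj (g w)) has_derivative (\<lambda>w. deriv h z * w + cnj (deriv g z * w))) (at z)"
      using h g by (intro harmonic_has_derivative) (auto elim: analytic_on_subset)
    \<comment> \<open>\<open>f\<close> agrees with \<open>h + cnj g\<close> only on the disk; as the
      disk is open, this determines the derivative at \<open>z\<close>.\<close>
    then have "(f has_derivative (\<lambda>w. deriv h z * w + cnj (deriv g z * w))) (at z)"
      by (rule has_derivative_transform_within_open [OF _ open_ball z]) (simp add: f_eq)
    then show ?thesis
      by (rule has_derivative_at_withinI)
  qed
  have inj: "inj_on f E"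
    using assms(3,7) by (auto simp: univalent_def intro: inj_on_subset)
  have fE: "f ` E \<in> sets lebesgue"
    using assms(6) der by (intro differentiable_image_in_sets_lebesgue)
      (auto simp: differentiable_on_def differentiable_def)
  have "emeasure lebesgue (f ` E) = (\<integral>\<^sup>+z\<in>E. ennreal \<bar>jacobian h g z\<bar> \<partial>lebesgue)"
    using emeasure_differentiable_image_eq_complex
        [where f' = "\<lambda>z w. deriv h z * w + cnj (deriv g z * w)", OF assms(6) der inj]
    by (simp only: jacobian_add_cnj jacobian_def)
  also have "\<dots> = (\<integral>\<^sup>+z\<in>E. ennreal (jacobian h g z) \<partial>lebesgue)"
    using assms(2,7) by (intro nn_integral_cong)
      (auto simp: sense_preserving_def subset_iff abs_of_pos split: split_indicator)
  finally have area: "emeasure lebesgue (f ` E) = (\<integral>\<^sup>+z\<in>E. ennreal (jacobian h g z) \<partial>lebesgue)" .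

  \<comment> \<open>The bound on the dilatation at the origin forces the sign. With
    \<open>k < 1\<close> it gives \<open>k\<^sup>2 \<le> 1\<close>, so
    \<open>ennreal (1 - k\<^sup>2)\<close> is not truncated to 0.\<close>
  have k: "0 \<le> k"
    using assms(4) order_trans [OF norm_ge_zero, of "dilatation h g 0" k] by simp
  have lower: "(1 - k\<^sup>2) * (cmod (deriv h z))\<^sup>2 \<le> jacobian h g z" if "z \<in> E" for z
  proof -
    have z: "z \<in> unit_disk"
      using that assms(7) by blast
    \<comment> \<open>At a zero of \<open>deriv h\<close> the quotient would be 0 by convention and
      its bound would say nothing about \<open>deriv g\<close>; the positive Jacobian rules this
      out.\<close>
    have "deriv h z \<noteq> 0"
      using assms(2) z by (force simp: sense_preserving_def jacobian_def)
    then have "cmod (deriv g z) \<le> k * cmod (deriv h z)"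
      using assms(4) z by (simp add: dilatation_def norm_divide divide_le_eq)
    then have "(cmod (deriv g z))\<^sup>2 \<le> (k * cmod (deriv h z))\<^sup>2"
      by (rule power_mono) simp
    then show ?thesis
      by (simp add: jacobian_def power_mult_distrib algebra_simps)
  qed
  \<comment> \<open>Continuity of \<open>deriv h\<close> yields the measurability needed to move the
    constant \<open>1 - k\<^sup>2\<close> under the integral.\<close>
  have "continuous_on E (\<lambda>z. (cmod (deriv h z))\<^sup>2)"
    using analytic_on_subset [OF analytic_deriv [OF h] assms(7)]
    by (intro continuous_intros analytic_imp_holomorphic holomorphic_on_imp_continuous_on)
  then have "(\<lambda>z. (cmod (deriv h z))\<^sup>2) \<in> borel_measurable (lebesgue_on E)"
    by (rule continuous_imp_measurable_on_sets_lebesgue [OF _ assms(6)])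
  then have meas: "(\<lambda>z. ennreal ((cmod (deriv h z))\<^sup>2) * indicator E z) \<in> borel_measurable lebesgue"
    using assms(6) by (subst borel_measurable_restrict_space_iff_ennreal [symmetric]) auto
  have "ennreal (1 - k\<^sup>2) * (\<integral>\<^sup>+z\<in>E. ennreal ((cmod (deriv h z))\<^sup>2) \<partial>lebesgue)
      = (\<integral>\<^sup>+z. ennreal (1 - k\<^sup>2) * (ennreal ((cmod (deriv h z))\<^sup>2) * indicator E z) \<partial>lebesgue)"
    by (rule nn_integral_cmult [OF meas, symmetric])
  also have "\<dots> \<le> (\<integral>\<^sup>+z\<in>E. ennreal (jacobian h g z) \<partial>lebesgue)"
    using k assms(5) lower
    by (intro nn_integral_mono)
      (auto simp: ennreal_mult' [symmetric] power_le_one intro!: ennreal_leI split: split_indicator)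
  also have "\<dots> = emeasure lebesgue (f ` E)"
    by (rule area [symmetric])
  finally have "ennreal (1 - k\<^sup>2) * (\<integral>\<^sup>+z\<in>E. ennreal ((cmod (deriv h z))\<^sup>2) \<partial>lebesgue)
      \<le> emeasure lebesgue (f ` E)" .
  moreover have "emeasure lebesgue (f ` E) \<le> (\<integral>\<^sup>+z\<in>E. ennreal ((cmod (deriv h z))\<^sup>2) \<partial>lebesgue)"
    unfolding area
    by (intro nn_integral_mono) (auto simp: jacobian_def intro!: ennreal_leI split: split_indicator)
  ultimately show ?thesis
    using fE by blast
qed

end
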